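(* Let $M = (C_1, \dotsc, C_n)$ be an MCS with logics $L_i$ over alphabet $\mathcal{A}_i$. (1) Every partial symmetry of $M$ w.r.t. $\{C_1, \dotsc, C_n\}$ is a symmetry of $M$. (2) For every partial symmetries $\pi$ and $\sigma$ of $M$ w.r.t. $C_{(\pi)} = \{C_{i_1},\dotsc,C_{i_m}\}$ and $C_{(\sigma)} = \{C_{j_1},\dotsc,C_{j_\ell}\}$, respectively, such that $\theta = \pi \bowtie \sigma$ is defined, $\theta$ is a partial symmetry of $M$ w.r.t. $C_{(\pi)} \cup C_{(\sigma)}$.
   Context: A logic is $L = (\mathrm{KB}, \mathrm{BS}, \mathrm{ACC})$ over an alphabet. A multi-context system (MCS) $M = (C_1,\dots,C_n)$ consists of contexts $C_i = (L_i, kb_i, br_i)$ where $L_i$ is a logic over alphabet $\mathcal{A}_i$, $kb_i$ is a knowledge base and $br_i$ is a set of bridge rules $a \leftarrow (c_1:b_1),\dots,(c_j:b_j), \mathit{not}\,(c_{j+1}:b_{j+1}),\dots,\mathit{not}\,(c_m:b_m)$ with $b_k \in \mathcal{A}_{c_k}$. The alphabets are pairwise disjoint and $\mathcal{A} = \bigcup_i \mathcal{A}_i$; $\mathrm{at}(br_i)$ denotes the set of atoms occurring in $br_i$. For a permutation $\pi$, $r^\pi$ applies $\pi$ to all atoms of a (bridge) rule or formula $r$ (context indices unchanged), $X^\pi = \{x^\pi \mid x \in X\}$, and $\mathrm{dom}(\pi)$ is the domain of $\pi$. A symmetry of $M$ is a permutation $\pi$ of $\mathcal{A}$ with $\mathcal{A}_i^\pi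 = \mathcal{A}_i$, $kb_i^\pi = kb_i$, $br_i^\pi = br_i$ for all $1 \le i \le n$. A permutation $\pi$ of the elements of $S \subseteq \mathcal{A}$ is a partial symmetry of $M$ w.r.t. $C = \{C_{i_1},\dots,C_{i_m}\}$ iff for all $1 \le k \le m$: $\mathcal{A}_{i_k} \cup \mathrm{at}(br_{i_k}) \subseteq S$, $\mathcal{A}_{i_k}^\pi = \mathcal{A}_{i_k}$, $kb_{i_k}^\pi = kb_{i_k}$, and $br_{i_k}^\pi = br_{i_k}$. The join $\pi \bowtie \sigma$ of partial symmetries is the permutation $\theta$ with $a^\theta = a^\pi$ if $a \in \mathrm{dom}(\pi)$ and $a^\theta = a^\sigma$ if $a \in \mathrm{dom}(\sigma)$, defined only when $a^\pi = a^\sigma$ for all $a \in \mathrm{dom}(\pi) \cap \mathrm{dom}(\sigma)$; otherwise undefined.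
   Formalization: The join is taken to be defined only if π and σ agree on the common domain and their union is a permutation; agreement alone suffices when the common domain is finite, but for infinite alphabets the union may fail to be injective. *)

theory Defs
  imports Main "HOL-Library.FSet"
begin

(* Knowledge bases are sets of formulas of an arbitrary syntax.  A logic therefore also records
   which atoms occur in a formula and how a permutation of the atoms is applied to it.  One type
   'f serves the formulas of all contexts; different syntaxes are combined by a sum type. *)
record ('a, 'f) mc_logic =
  alphabet :: "'a set"
  KB :: "'f set set"
  BS :: "'a set set"
  ACC :: "'f set \<Rightarrow> 'a set set"
  atoms_of :: "'f \<Rightarrow> 'a set"
  rename :: "('a \<Rightarrow> 'a) \<Rightarrow> 'f \<Rightarrow> 'f"

definition is_logic :: "('a, 'f) mc_logic \<Rightarrow> bool" where
  "is_logic L \<longleftrightarrow>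
     (\<forall>K \<in> KB L. \<forall>\<phi> \<in> K. atoms_of L \<phi> \<subseteq> alphabet L) \<and>
     (\<forall>B \<in> BS L. B \<subseteq> alphabet L) \<and>
     (\<forall>K \<in> KB L. ACC L K \<subseteq> BS L) \<and>
     (\<forall>\<phi>. rename L id \<phi> = \<phi>) \<and>
     (\<forall>f g \<phi>. bij f \<longrightarrow> bij g \<longrightarrow> rename L (f \<circ> g) \<phi> = rename L f (rename L g \<phi>)) \<and>
     (\<forall>f \<phi>. bij f \<longrightarrow> atoms_of L (rename L f \<phi>) = f ` atoms_of L \<phi>) \<and>
     (\<forall>f g \<phi>. bij f \<longrightarrow> bij g \<longrightarrow> (\<forall>a \<in> atoms_of L \<phi>. f a = g a) \<longrightarrow>
        rename L f \<phi> = rename L g \<phi>)"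

(* The body literals form finite sets.  The generated map_bridge_rule renames the atoms of a rule
   and keeps the context indices; set_bridge_rule collects all atoms, head included. *)
datatype 'a bridge_rule =
  Bridge_Rule (head: 'a) (pos_body: "(nat \<times> 'a) fset") (neg_body: "(nat \<times> 'a) fset")

definition atoms_br :: "'a bridge_rule set \<Rightarrow> 'a set" where
  "atoms_br R = (\<Union>r \<in> R. set_bridge_rule r)"

record ('a, 'f) mc_context =
  lgc :: "('a, 'f) mc_logic"
  kb :: "'f set"
  br :: "'a bridge_rule set"

abbreviation alph :: "('a, 'f) mc_context \<Rightarrow> 'a set" where
  "alph C \<equiv> alphabet (lgc C)"

type_synonym ('a, 'f) mcs = "('a, 'f) mc_context list"

(* Contexts are numbered from 1, as in bridge rules. *)
definition nth_ctx :: "('a, 'f) mcs \<Rightarrow> nat \<Rightarrow> ('a, 'f) mc_context" where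
  "nth_ctx M i = M ! (i - 1)"

definition atoms_mcs :: "('a, 'f) mcs \<Rightarrow> 'a set" where
  "atoms_mcs M = (\<Union>i \<in> {1..length M}. alph (nth_ctx M i))"

definition is_mcs :: "('a, 'f) mcs \<Rightarrow> bool" where
  "is_mcs M \<longleftrightarrow>
     (\<forall>i \<in> {1..length M}.
        is_logic (lgc (nth_ctx M i)) \<and>
        kb (nth_ctx M i) \<in> KB (lgc (nth_ctx M i)) \<and>
        (\<forall>r \<in> br (nth_ctx M i).
           head r \<in> atoms_mcs M \<and>
           (\<forall>(c, b) \<in> fset (pos_body r) \<union> fset (neg_body r).
              c \<in> {1..length M} \<and> b \<in> alph (nth_ctx M c)))) \<and>
     (\<forall>i \<in> {1..length M}. \<forall>j \<in> {1..length M}. i \<noteq> j \<longrightarrow>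
        alph (nth_ctx M i) \<inter> alph (nth_ctx M j) = {})"

(* A permutation is a partial map, so that its domain is recorded.  To act on formulas and rules
   it is extended by the identity. *)
definition app :: "('a \<rightharpoonup> 'a) \<Rightarrow> 'a \<Rightarrow> 'a" where
  "app \<pi> a = (case \<pi> a of None \<Rightarrow> a | Some b \<Rightarrow> b)"

definition permutation_of :: "'a set \<Rightarrow> ('a \<rightharpoonup> 'a) \<Rightarrow> bool" where
  "permutation_of S \<pi> \<longleftrightarrow> dom \<pi> = S \<and> bij_betw (app \<pi>) S S"

definition preserves :: "('a \<rightharpoonup> 'a) \<Rightarrow> ('a, 'f) mc_context \<Rightarrow> bool" where
  "preserves \<pi> C \<longleftrightarrow>
     app \<pi> ` alph C = alph C \<and>
     rename (lgc C) (app \<pi>) ` kb C = kb C \<and>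
     map_bridge_rule (app \<pi>) ` br C = br C"

definition symmetry :: "('a, 'f) mcs \<Rightarrow> ('a \<rightharpoonup> 'a) \<Rightarrow> bool" where
  "symmetry M \<pi> \<longleftrightarrow>
     permutation_of (atoms_mcs M) \<pi> \<and> (\<forall>i \<in> {1..length M}. preserves \<pi> (nth_ctx M i))"

definition partial_symmetry ::
    "('a, 'f) mcs \<Rightarrow> ('a, 'f) mc_context set \<Rightarrow> ('a \<rightharpoonup> 'a) \<Rightarrow> bool" where
  "partial_symmetry M \<C> \<pi> \<longleftrightarrow>
     \<C> \<subseteq> set M \<and>
     (\<exists>S. S \<subseteq> atoms_mcs M \<and> permutation_of S \<pi> \<and>
        (\<forall>C \<in> \<C>. alph C \<union> atoms_br (br C) \<subseteq> S \<and> preserves \<pi> C))"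

(* The join has to be a permutation.  If the domains have a finite intersection, agreement there
   already guarantees this (join_defined_iff below).  Over infinite alphabets it does not: two
   bijections that both shift the common part {0, 1, 2, ...} by one and enter it from disjoint
   private parts agree on it, but their union is not injective. *)
definition join :: "('a \<rightharpoonup> 'a) \<Rightarrow> ('a \<rightharpoonup> 'a) \<Rightarrow> ('a \<rightharpoonup> 'a) option" where
  "join \<pi> \<sigma> =
     (if (\<forall>a \<in> dom \<pi> \<inter> dom \<sigma>. app \<pi> a = app \<sigma> a) \<and>
         permutation_of (dom \<pi> \<union> dom \<sigma>) (\<pi> ++ \<sigma>)
      then Some (\<pi> ++ \<sigma>) else None)"

lemma join_eq_Some_iff:
  "join \<pi> \<sigma> = Some \<theta> \<longleftrightarrow>
     (\<forall>a \<in> dom \<pi> \<inter> dom \<sigma>. app \<pi> a = app \<sigma> a) \<and>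
     permutation_of (dom \<pi> \<union> dom \<sigma>) \<theta> \<and>
     (\<forall>a \<in> dom \<pi>. app \<theta> a = app \<pi> a) \<and> (\<forall>a \<in> dom \<sigma>. app \<theta> a = app \<sigma> a)"
  (is "?L \<longleftrightarrow> ?agree \<and> ?perm \<and> ?p \<and> ?s")
proof
  assume ?L
  then have a: ?agree and p: ?perm and t: "\<theta> = \<pi> ++ \<sigma>"
    by (auto simp: join_def split: if_splits)
  have ?s by (auto simp: t app_def)
  moreover have ?p
  proof
    fix x assume "x \<in> dom \<pi>"
    then show "app \<theta> x = app \<pi> x"
      using a by (cases "x \<in> dom \<sigma>") (auto simp: t app_def map_add_def split: option.splits)
  qed
  ultimately show "?agree \<and> ?perm \<and> ?p \<and> ?s" using a p by blast
next
  assume R: "?agree \<and> ?perm \<and> ?p \<and> ?s"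
  have "\<theta> x = (\<pi> ++ \<sigma>) x" for x
  proof -
    have d: "dom \<theta> = dom \<pi> \<union> dom \<sigma>" using R by (simp add: permutation_of_def)
    have e: "f x = g x" if "x \<in> dom f" "x \<in> dom g" "app f x = app g x" for f g :: "'a \<rightharpoonup> 'a"
      using that by (auto simp: app_def)
    consider "x \<in> dom \<sigma>" | "x \<in> dom \<pi>" "x \<notin> dom \<sigma>" | "x \<notin> dom \<pi>" "x \<notin> dom \<sigma>" by blast
    then show ?thesis
    proof cases
      case 1
      then have "\<theta> x = \<sigma> x" using R d by (intro e) simp_all
      then show ?thesis using 1 by (simp add: map_add_dom_app_simps)
    next
      case 2
      then have "\<theta> x = \<pi> x" using R d by (intro e) simp_all
      then show ?thesis using 2 by (simp add: map_add_dom_app_simps)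
    next
      case 3
      then have "x \<notin> dom \<theta>" using d by simp
      then show ?thesis using 3 by (simp add: domIff map_add_def)
    qed
  qed
  then have "\<theta> = \<pi> ++ \<sigma>" by blast
  then show ?L using R by (simp add: join_def)
qed

lemma join_defined_iff:
  assumes \<pi>: "permutation_of S \<pi>" and \<sigma>: "permutation_of T \<sigma>" and fin: "finite (S \<inter> T)"
  shows "(\<exists>\<theta>. join \<pi> \<sigma> = Some \<theta>) \<longleftrightarrow> (\<forall>a \<in> S \<inter> T. app \<pi> a = app \<sigma> a)"
proof
  assume "\<exists>\<theta>. join \<pi> \<sigma> = Some \<theta>"
  then show "\<forall>a \<in> S \<inter> T. app \<pi> a = app \<sigma> a"
    using \<pi> \<sigma> by (auto simp: join_def permutation_of_def split: if_splits)
next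
  assume agree: "\<forall>a \<in> S \<inter> T. app \<pi> a = app \<sigma> a"
  have d: "dom \<pi> = S" "dom \<sigma> = T" and bp: "bij_betw (app \<pi>) S S" and bs: "bij_betw (app \<sigma>) T T"
    using \<pi> \<sigma> by (auto simp: permutation_of_def)
  let ?t = "\<pi> ++ \<sigma>"
  have ts: "app ?t a = app \<sigma> a" if "a \<in> T" for a
    using that d by (auto simp: app_def)
  have tp: "app ?t a = app \<pi> a" if "a \<in> S" for a
    using that agree ts d by (cases "a \<in> T") (auto simp: app_def map_add_def split: option.splits)
  have imI: "app \<pi> ` (S \<inter> T) = S \<inter> T"
  proof (rule card_subset_eq[OF fin])
    show "app \<pi> ` (S \<inter> T) \<subseteq> S \<inter> T"
    proof
      fix y assume "y \<in> app \<pi> ` (S \<inter> T)"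
      then obtain x where x: "x \<in> S" "x \<in> T" "y = app \<pi> x" by blast
      then have "y = app \<sigma> x" using agree by simp
      then show "y \<in> S \<inter> T"
        using x bij_betw_apply[OF bp, of x] bij_betw_apply[OF bs, of x] by auto
    qed
    show "card (app \<pi> ` (S \<inter> T)) = card (S \<inter> T)"
      using bp by (intro card_image) (auto simp: bij_betw_def inj_on_def)
  qed
  have "app \<pi> ` (S - S \<inter> T) = app \<pi> ` S - app \<pi> ` (S \<inter> T)"
    using bp by (intro inj_on_image_set_diff[of _ S]) (auto simp: bij_betw_def)
  then have "app \<pi> ` (S - T) = S - T"
    using bp imI by (simp add: bij_betw_def Diff_Int)
  then have bD: "bij_betw (app \<pi>) (S - T) (S - T)"
    using bp by (auto simp: bij_betw_def inj_on_def)
  have "bij_betw (app ?t) ((S - T) \<union> T) ((S - T) \<union> T)"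
  proof (rule bij_betw_combine)
    show "bij_betw (app ?t) (S - T) (S - T)"
      using bD by (rule bij_betw_cong[THEN iffD1, rotated]) (simp add: tp)
    show "bij_betw (app ?t) T T"
      using bs by (rule bij_betw_cong[THEN iffD1, rotated]) (simp add: ts)
  qed auto
  then have "permutation_of (S \<union> T) ?t"
    using d by (auto simp: permutation_of_def Un_commute)
  then show "\<exists>\<theta>. join \<pi> \<sigma> = Some \<theta>"
    using agree d by (auto simp: join_def)
qed

end

theory Submission
  imports Defs
begin

text \<open>For the first claim, the set permuted by a partial symmetry w.r.t. all contexts contains
  every alphabet and lies in their union, so it is all of \<open>atoms_mcs M\<close>. The second
  claim rests on locality: whether a permutation preserves a context depends only on its values on
  the alphabet and the bridge-rule atoms of that context (\<open>preserves_cong\<close>). These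
  atoms lie in the domain of the partial symmetry, so any larger permutation agreeing with it there
  preserves the same contexts (\<open>partial_symmetry_extend\<close>). The join extends both \<pi>
  and \<sigma>, hence preserves the contexts of both.\<close>

text \<open>Partial symmetries refer to sets of contexts, while \<open>is_mcs\<close> and
  \<open>symmetry\<close> quantify over indices starting at 1; this translates between the
  two.\<close>

lemma set_eq_nth_ctx_image: "set M = nth_ctx M ` {1..length M}"
proof -
  have "{1..length M} = Suc ` {..<length M}"
    by (simp add: image_Suc_lessThan)
  then show ?thesis
    by (auto simp: nth_ctx_def set_conv_nth image_image)
qed

lemma atoms_mcs_eq: "atoms_mcs M = (\<Union>C \<in> set M. alph C)"
  by (simp add: atoms_mcs_def set_eq_nth_ctx_image)

lemma is_mcs_context:
  assumes "is_mcs M" and "C \<in> set M"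
  shows "is_logic (lgc C)" and "kb C \<in> KB (lgc C)"
  using assms by (auto simp: is_mcs_def set_eq_nth_ctx_image)

text \<open>The laws for \<open>rename\<close> in \<open>is_logic\<close> concern bijections of the
  whole atom type, so the extension by the identity has to be one.\<close>

lemma permutation_of_imp_bij_app:
  assumes "permutation_of S \<pi>"
  shows "bij (app \<pi>)"
proof -
  have "bij_betw (app \<pi>) S S" and d: "dom \<pi> = S"
    using assms by (auto simp: permutation_of_def)
  moreover have "bij_betw (app \<pi>) (- S) (- S)"
    by (rule bij_betw_cong[THEN iffD1, OF _ bij_betw_id]) (use d in \<open>auto simp: app_def domIff\<close>)
  ultimately have "bij_betw (app \<pi>) (S \<union> - S) (S \<union> - S)"
    by (intro bij_betw_combine) auto
  then show ?thesis
    by simp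
qed

text \<open>Formulas of \<open>kb C\<close> have their atoms in the alphabet, because
  \<open>kb C\<close> is a knowledge base of the logic, and \<open>rename\<close> depends only on
  the values at these atoms. Bridge rules are handled by the congruence rule of their map
  function.\<close>

lemma preserves_cong:
  assumes logic: "is_logic (lgc C)" and kb: "kb C \<in> KB (lgc C)"
    and bij: "bij (app \<pi>)" "bij (app \<theta>)"
    and eq: "\<And>a. a \<in> alph C \<union> atoms_br (br C) \<Longrightarrow> app \<theta> a = app \<pi> a"
  shows "preserves \<theta> C \<longleftrightarrow> preserves \<pi> C"
proof -
  have "app \<theta> ` alph C = app \<pi> ` alph C"
    using eq by (intro image_cong) auto
  moreover have "rename (lgc C) (app \<theta>) ` kb C = rename (lgc C) (app \<pi>) ` kb C"
  proof (intro image_cong refl)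
    fix \<phi> assume "\<phi> \<in> kb C"
    then have "atoms_of (lgc C) \<phi> \<subseteq> alph C"
      using logic kb by (auto simp: is_logic_def)
    then have "\<forall>a \<in> atoms_of (lgc C) \<phi>. app \<theta> a = app \<pi> a"
      using eq by auto
    then show "rename (lgc C) (app \<theta>) \<phi> = rename (lgc C) (app \<pi>) \<phi>"
      using logic bij unfolding is_logic_def by blast
  qed
  moreover have "map_bridge_rule (app \<theta>) ` br C = map_bridge_rule (app \<pi>) ` br C"
    using eq by (intro image_cong refl bridge_rule.map_cong) (auto simp: atoms_br_def)
  ultimately show ?thesis
    by (simp add: preserves_def)
qed

lemma partial_symmetry_all_imp_symmetry:
  assumes "partial_symmetry M (set M) \<pi>"
  shows "symmetry M \<pi>"
proof -
  obtain S where S: "S \<subseteq> atoms_mcs M" "permutation_of S \<pi>"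
    and C: "\<And>C. C \<in> set M \<Longrightarrow> alph C \<union> atoms_br (br C) \<subseteq> S \<and> preserves \<pi> C"
    using assms by (auto simp: partial_symmetry_def)
  \<comment> \<open>Each alphabet is contained in \<open>S\<close>, and their union is
    \<open>atoms_mcs M\<close>.\<close>
  have "S = atoms_mcs M"
    using S(1) C by (force simp: atoms_mcs_eq)
  then show ?thesis
    using S(2) C by (auto simp: symmetry_def set_eq_nth_ctx_image)
qed

lemma partial_symmetry_extend:
  assumes M: "is_mcs M" and \<pi>: "partial_symmetry M \<C> \<pi>"
    and \<theta>: "permutation_of T \<theta>" "T \<subseteq> atoms_mcs M" "dom \<pi> \<subseteq> T"
    and eq: "\<And>a. a \<in> dom \<pi> \<Longrightarrow> app \<theta> a = app \<pi> a"
  shows "partial_symmetry M \<C> \<theta>"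
proof -
  \<comment> \<open>The set \<open>S\<close> hidden in \<open>partial_symmetry\<close> can only be
    \<open>dom \<pi>\<close>.\<close>
  have sub: "\<C> \<subseteq> set M" and perm: "permutation_of (dom \<pi>) \<pi>"
    and C: "\<And>C. C \<in> \<C> \<Longrightarrow> alph C \<union> atoms_br (br C) \<subseteq> dom \<pi> \<and> preserves \<pi> C"
    using \<pi> by (auto simp: partial_symmetry_def permutation_of_def)
  have "alph C \<union> atoms_br (br C) \<subseteq> T \<and> preserves \<theta> C" if "C \<in> \<C>" for C
  proof -
    have "preserves \<theta> C \<longleftrightarrow> preserves \<pi> C"
    proof (rule preserves_cong)
      show "is_logic (lgc C)" "kb C \<in> KB (lgc C)"
        using is_mcs_context[OF M] that sub by blast+
      show "bij (app \<pi>)" "bij (app \<theta>)"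
        using permutation_of_imp_bij_app perm \<theta>(1) by auto
      show "app \<theta> a = app \<pi> a" if "a \<in> alph C \<union> atoms_br (br C)" for a
        using eq that C[OF \<open>C \<in> \<C>\<close>] by blast
    qed
    then show ?thesis
      using C[OF that] \<theta>(3) by auto
  qed
  then show ?thesis
    using sub \<theta> by (auto simp: partial_symmetry_def)
qed

text \<open>Both hypotheses have the same witness \<open>dom \<theta>\<close>, so their conditions
  on contexts can be merged.\<close>

lemma partial_symmetry_Un:
  assumes "partial_symmetry M \<C>\<^sub>1 \<theta>" and "partial_symmetry M \<C>\<^sub>2 \<theta>"
  shows "partial_symmetry M (\<C>\<^sub>1 \<union> \<C>\<^sub>2) \<theta>"
  using assms by (auto simp: partial_symmetry_def permutation_of_def)

lemma partial_symmetry_dom_subset: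
  "partial_symmetry M \<C> \<pi> \<Longrightarrow> dom \<pi> \<subseteq> atoms_mcs M"
  by (auto simp: partial_symmetry_def permutation_of_def)

lemma partial_symmetry_join:
  assumes M: "is_mcs M"
    and \<pi>: "partial_symmetry M \<C>\<^sub>1 \<pi>" and \<sigma>: "partial_symmetry M \<C>\<^sub>2 \<sigma>"
    and join: "join \<pi> \<sigma> = Some \<theta>"
  shows "partial_symmetry M (\<C>\<^sub>1 \<union> \<C>\<^sub>2) \<theta>"
proof -
  \<comment> \<open>Since \<open>join_eq_Some_iff\<close> is symmetric in \<pi> and \<sigma>, the
    precedence built into \<open>++\<close> disappears and one extension argument serves
    both.\<close>
  have perm: "permutation_of (dom \<pi> \<union> dom \<sigma>) \<theta>"
    and eq: "\<And>a. a \<in> dom \<pi> \<Longrightarrow> app \<theta> a = app \<pi> a" "\<And>a. a \<in> dom \<sigma> \<Longrightarrow> app \<theta> a = app \<sigma> a"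
    using join unfolding join_eq_Some_iff by blast+
  have sub: "dom \<pi> \<union> dom \<sigma> \<subseteq> atoms_mcs M"
    using partial_symmetry_dom_subset[OF \<pi>] partial_symmetry_dom_subset[OF \<sigma>] by (rule Un_least)
  show ?thesis
    using partial_symmetry_extend[OF M \<pi> perm sub Un_upper1 eq(1)]
      partial_symmetry_extend[OF M \<sigma> perm sub Un_upper2 eq(2)]
    by (rule partial_symmetry_Un)
qed

theorem theorem1:
  fixes M :: "('a, 'f) mcs"
  assumes "is_mcs M"
  shows "(\<forall>\<pi>. partial_symmetry M (set M) \<pi> \<longrightarrow> symmetry M \<pi>) \<and>
    (\<forall>\<pi> \<sigma> \<theta> \<C>\<^sub>1 \<C>\<^sub>2. partial_symmetry M \<C>\<^sub>1 \<pi> \<longrightarrow> partial_symmetry M \<C>\<^sub>2 \<sigma> \<longrightarrow>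
       join \<pi> \<sigma> = Some \<theta> \<longrightarrow> partial_symmetry M (\<C>\<^sub>1 \<union> \<C>\<^sub>2) \<theta>)"
  using partial_symmetry_all_imp_symmetry partial_symmetry_join[OF assms] by blast

end
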